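(* Let $T$ be a continuous t-norm and $\boldsymbol\Omega=(\omega_1,\dots,\omega_n)^\top$ a weight vector with $\omega_\ell\in(0,1]$ and $\sum_{\ell=1}^n\omega_\ell=1$. For $\gamma_1,\dots,\gamma_n\in\tilde{\mathbb I}$ write $\langle\mu_A,\nu_A\rangle=\mathrm{IFWA}_{T,\boldsymbol\Omega}(\gamma_1,\dots,\gamma_n)$, $\langle\mu_G,\nu_G\rangle=\mathrm{IFWG}_{T,\boldsymbol\Omega}(\gamma_1,\dots,\gamma_n)$ and $\mathrm{IFMWAG}_{T,\boldsymbol\Omega}(\gamma_1,\dots,\gamma_n)=\left\langle\frac{\mu_A+\mu_G}{2},\frac{\nu_A+\nu_G}{2}\right\rangle$. Then: (1) $\mathrm{IFMWAG}_{T,\boldsymbol\Omega}(\gamma_1,\dots,\gamma_n)\in\tilde{\mathbb I}$. (2) $\frac{\mu_A+\mu_G}{2}=0$ if and only if $\mu_{\gamma_1}=\cdots=\mu_{\gamma_n}=0$; and $\frac{\mu_A+\mu_G}{2}=1$ if and only if $\mu_{\gamma_1}=\cdots=\mu_{\gamma_n}=1$. (3) $\mathrm{IFMWAG}_{T,\boldsymbol\Omega}$ is idempotent (it takes the value $\gamma$ if $\gamma_1=\cdots=\gamma_n=\gamma$), bounded ($\gamma^-\le_{\mathrm{Xu}}\mathrm{IFMWAG}_{T,\boldsymbol\Omega}(\gamma_1,\dots,\gamma_n)\le_{\mathrm{Xu}}\gamma^+$, where $\gamma^-=\langle\min_j\mu_{\gamma_j},\max_j\nu_{\gamma_j}\rangle$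 and $\gamma^+=\langle\max_j\mu_{\gamma_j},\min_j\nu_{\gamma_j}\rangle$), and monotonous (if $\beta_j\in\tilde{\mathbb I}$ with $\mu_{\beta_j}\ge\mu_{\gamma_j}$ and $\nu_{\beta_j}\le\nu_{\gamma_j}$ for all $j$, then $\mathrm{IFMWAG}_{T,\boldsymbol\Omega}(\gamma_1,\dots,\gamma_n)\le_{\mathrm{Xu}}\mathrm{IFMWAG}_{T,\boldsymbol\Omega}(\beta_1,\dots,\beta_n)$). (4) If $T=T_{\mathbf P}$ is the algebraic product, $T_{\mathbf P}(u,v)=uv$, then $$\mathrm{IFMWAG}_{T_{\mathbf P},\boldsymbol\Omega}(\gamma_1,\dots,\gamma_n)=\left\langle\frac{1-\prod_{\ell=1}^n(1-\mu_{\gamma_\ell})^{\omega_\ell}+\prod_{\ell=1}^n(\mu_{\gamma_\ell})^{\omega_\ell}}{2},\ \frac{1-\prod_{\ell=1}^n(1-\nu_{\gamma_\ell})^{\omega_\ell}+\prod_{\ell=1}^n(\nu_{\gamma_\ell})^{\omega_\ell}}{2}\right\rangle.$$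
   Context: A t-norm is a map $T:[0,1]^2\to[0,1]$ that is commutative, associative, nondecreasing in each argument, with $T(x,1)=x$; a t-conorm $S$ satisfies the same with $S(x,0)=x$ in place of $T(x,1)=x$. The dual t-conorm of $T$ is $S(x,y)=1-T(1-x,1-y)$. Powers: $\mathbb N=\{1,2,\dots\}$. $x_T^{(0)}=1$, $x_T^{(1)}=x$, $x_T^{(n)}=T(x_T^{(n-1)},x)$, and $x_S^{(0)}=0$, $x_S^{(1)}=x$, $x_S^{(n)}=S(x_S^{(n-1)},x)$. For $T,S$ continuous, $u\in[0,1]$, $p,q\in\mathbb N$: $u_T^{(1/p)}=\sup\{v\in[0,1]\mid v_T^{(p)}<u\}$ ($\sup\varnothing=0$), $u_S^{(1/p)}=\inf\{v\in[0,1]\mid v_S^{(p)}>u\}$ ($\inf\varnothing=1$), $u_T^{(q/p)}=(u_T^{(1/p)})_T^{(q)}$, $u_S^{(q/p)}=(u_S^{(1/p)})_S^{(q)}$ (independent of the representation of the fraction). For real $t>0$: $u_T^{(t)}=\inf\{u_T^{(r)}\mid r\in[0,t]\cap\mathbb Q\}$ and $u_S^{(t)}=\sup\{u_S^{(r)}\mid r\in[0,t]\cap\mathbb Q\}$ (these agree with the preceding definitions for rational $t>0$). Intuitionistic fuzzy values (IFVs): $\tilde{\mathbb I}=\{\langle\mu,\nu\rangle\in[0,1]^2\mid\mu+\nu\le1\}$; $\alpha\in\tilde{\mathbb I}$ is written $\langle\mu_\alpha,\nu_\alpha\rangle$. For a continuous t-norm $T$ with dual t-conorm $S$, $\alpha,\beta\in\tilde{\mathbb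 I}$, $\lambda>0$: $\alpha\oplus_T\beta=\langle S(\mu_\alpha,\mu_\beta),T(\nu_\alpha,\nu_\beta)\rangle$; $\alpha\otimes_T\beta=\langle T(\mu_\alpha,\mu_\beta),S(\nu_\alpha,\nu_\beta)\rangle$; $\lambda_T\alpha=\langle(\mu_\alpha)_S^{(\lambda)},(\nu_\alpha)_T^{(\lambda)}\rangle$; $\alpha^{\lambda_T}=\langle(\mu_\alpha)_T^{(\lambda)},(\nu_\alpha)_S^{(\lambda)}\rangle$; all of these lie in $\tilde{\mathbb I}$. Define $\mathrm{IFWA}_{T,\boldsymbol\Omega}(\gamma_1,\dots,\gamma_n)=((\omega_1)_T\gamma_1)\oplus_T\cdots\oplus_T((\omega_n)_T\gamma_n)$ and $\mathrm{IFWG}_{T,\boldsymbol\Omega}(\gamma_1,\dots,\gamma_n)=(\gamma_1^{(\omega_1)_T})\otimes_T\cdots\otimes_T(\gamma_n^{(\omega_n)_T})$. Order: for $\alpha\in\tilde{\mathbb I}$ let $S(\alpha)=\mu_\alpha-\nu_\alpha$ (score) and $A(\alpha)=\mu_\alpha+\nu_\alpha$ (accuracy). Then $\alpha<_{\mathrm{Xu}}\beta$ iff $S(\alpha)<S(\beta)$, or $S(\alpha)=S(\beta)$ and $A(\alpha)<A(\beta)$; $\alpha\le_{\mathrm{Xu}}\beta$ iff $\alpha<_{\mathrm{Xu}}\beta$ or $\alpha=\beta$. *)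

theory Defs
  imports "HOL-Analysis.Analysis"
begin

text \<open>
  Operations on the unit interval are total functions on the reals; all conditions
  on them are relativised to \<open>{0..1}\<close>, and values outside are irrelevant.
\<close>

definition tnorm :: "(real \<Rightarrow> real \<Rightarrow> real) \<Rightarrow> bool" where
  "tnorm T \<longleftrightarrow>
     (\<forall>x\<in>{0..1}. \<forall>y\<in>{0..1}. T x y \<in> {0..1}) \<and>
     (\<forall>x\<in>{0..1}. \<forall>y\<in>{0..1}. T x y = T y x) \<and>
     (\<forall>x\<in>{0..1}. \<forall>y\<in>{0..1}. \<forall>z\<in>{0..1}. T (T x y) z = T x (T y z)) \<and>
     (\<forall>x\<in>{0..1}. \<forall>x'\<in>{0..1}. \<forall>y\<in>{0..1}. \<forall>y'\<in>{0..1}.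
        x \<le> x' \<longrightarrow> y \<le> y' \<longrightarrow> T x y \<le> T x' y') \<and>
     (\<forall>x\<in>{0..1}. T x 1 = x)"

definition continuous_tnorm :: "(real \<Rightarrow> real \<Rightarrow> real) \<Rightarrow> bool" where
  "continuous_tnorm T \<longleftrightarrow>
     tnorm T \<and> continuous_on ({0..1} \<times> {0..1}) (\<lambda>(x, y). T x y)"

definition dual_tconorm :: "(real \<Rightarrow> real \<Rightarrow> real) \<Rightarrow> real \<Rightarrow> real \<Rightarrow> real" where
  "dual_tconorm T x y = 1 - T (1 - x) (1 - y)"

definition algebraic_product :: "real \<Rightarrow> real \<Rightarrow> real" where
  "algebraic_product u v = u * v"


subsection \<open>Powers with respect to a t-norm and a t-conorm\<close>

fun tnorm_npow :: "(real \<Rightarrow> real \<Rightarrow> real) \<Rightarrow> real \<Rightarrow> nat \<Rightarrow> real" where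
  "tnorm_npow T x 0 = 1"
| "tnorm_npow T x (Suc 0) = x"
| "tnorm_npow T x (Suc (Suc n)) = T (tnorm_npow T x (Suc n)) x"

fun tconorm_npow :: "(real \<Rightarrow> real \<Rightarrow> real) \<Rightarrow> real \<Rightarrow> nat \<Rightarrow> real" where
  "tconorm_npow S x 0 = 0"
| "tconorm_npow S x (Suc 0) = x"
| "tconorm_npow S x (Suc (Suc n)) = S (tconorm_npow S x (Suc n)) x"

text \<open>
  The supremum and infimum are taken in \<open>[0,1]\<close>, where the empty set has supremum 0
  and infimum 1; on the reals both are unspecified, hence the case distinctions.
\<close>

definition tnorm_root :: "(real \<Rightarrow> real \<Rightarrow> real) \<Rightarrow> real \<Rightarrow> nat \<Rightarrow> real" where
  "tnorm_root T u p =
     (let V = {v \<in> {0..1}. tnorm_npow T v p < u} in if V = {} then 0 else Sup V)"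

definition tconorm_root :: "(real \<Rightarrow> real \<Rightarrow> real) \<Rightarrow> real \<Rightarrow> nat \<Rightarrow> real" where
  "tconorm_root S u p =
     (let V = {v \<in> {0..1}. tconorm_npow S v p > u} in if V = {} then 1 else Inf V)"

text \<open>The power with exponent \<open>q / p\<close>, as a function of numerator and denominator.\<close>

definition tnorm_qpow :: "(real \<Rightarrow> real \<Rightarrow> real) \<Rightarrow> real \<Rightarrow> nat \<Rightarrow> nat \<Rightarrow> real" where
  "tnorm_qpow T u q p = tnorm_npow T (tnorm_root T u p) q"

definition tconorm_qpow :: "(real \<Rightarrow> real \<Rightarrow> real) \<Rightarrow> real \<Rightarrow> nat \<Rightarrow> nat \<Rightarrow> real" where
  "tconorm_qpow S u q p = tconorm_npow S (tconorm_root S u p) q"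

text \<open>
  The rationals in \<open>[0,t]\<close> are enumerated by all their representations \<open>q / p\<close>, on which
  the value does not depend; \<open>q = 0\<close> is the exponent 0.
\<close>

definition tnorm_rpow :: "(real \<Rightarrow> real \<Rightarrow> real) \<Rightarrow> real \<Rightarrow> real \<Rightarrow> real" where
  "tnorm_rpow T u t = Inf {tnorm_qpow T u q p | q p. 1 \<le> p \<and> real q / real p \<le> t}"

definition tconorm_rpow :: "(real \<Rightarrow> real \<Rightarrow> real) \<Rightarrow> real \<Rightarrow> real \<Rightarrow> real" where
  "tconorm_rpow S u t = Sup {tconorm_qpow S u q p | q p. 1 \<le> p \<and> real q / real p \<le> t}"


subsection \<open>Intuitionistic fuzzy values\<close>

type_synonym ifv = "real \<times> real"

abbreviation mem :: "ifv \<Rightarrow> real" ("\<mu>") where "\<mu> \<alpha> \<equiv> fst \<alpha>"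
abbreviation nonmem :: "ifv \<Rightarrow> real" ("\<nu>") where "\<nu> \<alpha> \<equiv> snd \<alpha>"

definition IFV :: "ifv set" where
  "IFV = {\<alpha>. \<mu> \<alpha> \<in> {0..1} \<and> \<nu> \<alpha> \<in> {0..1} \<and> \<mu> \<alpha> + \<nu> \<alpha> \<le> 1}"

definition ifv_add :: "(real \<Rightarrow> real \<Rightarrow> real) \<Rightarrow> ifv \<Rightarrow> ifv \<Rightarrow> ifv" where
  "ifv_add T \<alpha> \<beta> = (dual_tconorm T (\<mu> \<alpha>) (\<mu> \<beta>), T (\<nu> \<alpha>) (\<nu> \<beta>))"

definition ifv_mult :: "(real \<Rightarrow> real \<Rightarrow> real) \<Rightarrow> ifv \<Rightarrow> ifv \<Rightarrow> ifv" where
  "ifv_mult T \<alpha> \<beta> = (T (\<mu> \<alpha>) (\<mu> \<beta>), dual_tconorm T (\<nu> \<alpha>) (\<nu> \<beta>))"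

definition ifv_scale :: "(real \<Rightarrow> real \<Rightarrow> real) \<Rightarrow> real \<Rightarrow> ifv \<Rightarrow> ifv" where
  "ifv_scale T l \<alpha> = (tconorm_rpow (dual_tconorm T) (\<mu> \<alpha>) l, tnorm_rpow T (\<nu> \<alpha>) l)"

definition ifv_power :: "(real \<Rightarrow> real \<Rightarrow> real) \<Rightarrow> ifv \<Rightarrow> real \<Rightarrow> ifv" where
  "ifv_power T \<alpha> l = (tnorm_rpow T (\<mu> \<alpha>) l, tconorm_rpow (dual_tconorm T) (\<nu> \<alpha>) l)"

text \<open>
  Families \<open>\<gamma>\<^sub>1, \<dots>, \<gamma>\<^sub>n\<close> with \<open>n \<ge> 1\<close> are functions on the naturals of which only the
  values on \<open>{1..n}\<close> matter; the iterated operations are bracketed to the left.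
\<close>

definition IFWA :: "(real \<Rightarrow> real \<Rightarrow> real) \<Rightarrow> (nat \<Rightarrow> real) \<Rightarrow> nat \<Rightarrow> (nat \<Rightarrow> ifv) \<Rightarrow> ifv" where
  "IFWA T \<omega> n \<gamma> =
     foldl (ifv_add T) (ifv_scale T (\<omega> 1) (\<gamma> 1))
       (map (\<lambda>l. ifv_scale T (\<omega> l) (\<gamma> l)) [2..<Suc n])"

definition IFWG :: "(real \<Rightarrow> real \<Rightarrow> real) \<Rightarrow> (nat \<Rightarrow> real) \<Rightarrow> nat \<Rightarrow> (nat \<Rightarrow> ifv) \<Rightarrow> ifv" where
  "IFWG T \<omega> n \<gamma> =
     foldl (ifv_mult T) (ifv_power T (\<gamma> 1) (\<omega> 1))
       (map (\<lambda>l. ifv_power T (\<gamma> l) (\<omega> l)) [2..<Suc n])"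

definition IFMWAG :: "(real \<Rightarrow> real \<Rightarrow> real) \<Rightarrow> (nat \<Rightarrow> real) \<Rightarrow> nat \<Rightarrow> (nat \<Rightarrow> ifv) \<Rightarrow> ifv" where
  "IFMWAG T \<omega> n \<gamma> =
     ((\<mu> (IFWA T \<omega> n \<gamma>) + \<mu> (IFWG T \<omega> n \<gamma>)) / 2,
      (\<nu> (IFWA T \<omega> n \<gamma>) + \<nu> (IFWG T \<omega> n \<gamma>)) / 2)"


subsection \<open>The order of Xu\<close>

definition score :: "ifv \<Rightarrow> real" where
  "score \<alpha> = \<mu> \<alpha> - \<nu> \<alpha>"

definition accuracy :: "ifv \<Rightarrow> real" where
  "accuracy \<alpha> = \<mu> \<alpha> + \<nu> \<alpha>"

definition less_Xu :: "ifv \<Rightarrow> ifv \<Rightarrow> bool" (infix "<\<^sub>X\<^sub>u" 50) where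
  "\<alpha> <\<^sub>X\<^sub>u \<beta> \<longleftrightarrow> score \<alpha> < score \<beta> \<or> (score \<alpha> = score \<beta> \<and> accuracy \<alpha> < accuracy \<beta>)"

definition le_Xu :: "ifv \<Rightarrow> ifv \<Rightarrow> bool" (infix "\<le>\<^sub>X\<^sub>u" 50) where
  "\<alpha> \<le>\<^sub>X\<^sub>u \<beta> \<longleftrightarrow> \<alpha> <\<^sub>X\<^sub>u \<beta> \<or> \<alpha> = \<beta>"

end

theory Submission
  imports Defs
begin

text \<open>
  Dualising every t-conorm power and every t-conorm sum expresses both aggregation operators
  through a single function of a family \<open>x\<close> of degrees, the weighted aggregate \<open>G x\<close>, which
  is the \<open>T\<close>-product of the powers of the \<open>x l\<close> with exponents \<open>\<omega> l\<close>: the weighted average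
  is \<open>(1 - G (1 - \<mu>), G \<nu>)\<close> and the weighted geometric mean is \<open>(G \<mu>, 1 - G (1 - \<nu>))\<close>
  (lemmas \<open>IFWA_agg\<close> and \<open>IFWG_agg\<close>). The mixed operator thus applies one and the same scalar
  mean \<open>M x = (1 - G (1 - x) + G x) / 2\<close> to the membership and to the nonmembership degrees.

  Everything then follows from three properties of \<open>G\<close>. It is monotone (\<open>agg_mono\<close>), so that
  \<open>M\<close> is monotone, and the inequality \<open>\<nu> \<le> 1 - \<mu>\<close> gives \<open>M \<mu> + M \<nu> \<le> 1\<close>. It takes the value
  1 only on the constant family 1 (\<open>agg_eq_one\<close>); as \<open>M x = 0\<close> means \<open>G (1 - x) = 1\<close> and
  \<open>G x = 0\<close>, and symmetrically for \<open>M x = 1\<close>, this settles the extreme values. It reproduces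
  constants (\<open>agg_const\<close>), which gives idempotency and, with monotonicity, the bounds;
  componentwise inequalities imply those in the order of Xu.

  Only the last property is deep: it needs the exponent law
  \<open>T (u\<^sup>s) (u\<^sup>t) = u\<^sup>s\<^sup>+\<^sup>t\<close> for real exponents of a continuous t-norm that need not be
  Archimedean (\<open>rpow_add_pos\<close>). For rational exponents the law follows from the fact that the
  root is the least one (\<open>npow_root_mult\<close>). For real exponents left continuity in the exponent
  is required, and it holds because the powers with exponent tending to 0 converge to an
  idempotent of \<open>T\<close>, which leaves all values below it unchanged (\<open>rpow_small_exp_unit\<close>).

  For the algebraic product the root is \<open>u powr (1 / p)\<close>, so the powers of the t-norm are
  the usual real powers (\<open>rpow_prod\<close>) and \<open>G\<close> is the weighted geometric mean of real numbers.
\<close>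

section \<open>Continuous t-norms and their natural powers\<close>

locale cont_tnorm =
  fixes T :: "real \<Rightarrow> real \<Rightarrow> real"
  assumes cont_tnorm: "continuous_tnorm T"
begin

lemma tnorm: "tnorm T"
  using cont_tnorm by (simp add: continuous_tnorm_def)

lemma T_in [simp]: "x \<in> {0..1} \<Longrightarrow> y \<in> {0..1} \<Longrightarrow> T x y \<in> {0..1}"
  using tnorm unfolding tnorm_def by blast

lemma T_comm: "x \<in> {0..1} \<Longrightarrow> y \<in> {0..1} \<Longrightarrow> T x y = T y x"
  using tnorm unfolding tnorm_def by blast

lemma T_assoc:
  "x \<in> {0..1} \<Longrightarrow> y \<in> {0..1} \<Longrightarrow> z \<in> {0..1} \<Longrightarrow> T (T x y) z = T x (T y z)"
  using tnorm unfolding tnorm_def by blast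

lemma T_mono:
  "x \<in> {0..1} \<Longrightarrow> x' \<in> {0..1} \<Longrightarrow> y \<in> {0..1} \<Longrightarrow> y' \<in> {0..1} \<Longrightarrow> x \<le> x' \<Longrightarrow> y \<le> y' \<Longrightarrow>
     T x y \<le> T x' y'"
  using tnorm unfolding tnorm_def by blast

lemma T_one_right [simp]: "x \<in> {0..1} \<Longrightarrow> T x 1 = x"
  using tnorm unfolding tnorm_def by blast

lemma T_one_left [simp]: "x \<in> {0..1} \<Longrightarrow> T 1 x = x"
  using T_comm[of 1 x] by simp

lemma T_le_left: "x \<in> {0..1} \<Longrightarrow> y \<in> {0..1} \<Longrightarrow> T x y \<le> x"
  using T_mono[of x x y 1] by simp

lemma T_le_right: "x \<in> {0..1} \<Longrightarrow> y \<in> {0..1} \<Longrightarrow> T x y \<le> y"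
  using T_mono[of x 1 y y] by simp

lemma continuous_T [continuous_intros]:
  assumes "continuous_on A f" "continuous_on A g" "f ` A \<subseteq> {0..1}" "g ` A \<subseteq> {0..1}"
  shows "continuous_on A (\<lambda>x. T (f x) (g x))"
proof -
  have c: "continuous_on ({0..1} \<times> {0..1}) (\<lambda>(x, y). T x y)"
    using cont_tnorm by (simp add: continuous_tnorm_def)
  have "continuous_on A (\<lambda>x. (f x, g x))"
    using assms by (intro continuous_intros)
  then have "continuous_on A (\<lambda>x. (\<lambda>(x, y). T x y) (f x, g x))"
    by (rule continuous_on_compose2[OF c]) (use assms in auto)
  then show ?thesis by simp
qed

lemma tendsto_T:
  fixes f g :: "nat \<Rightarrow> real"
  assumes "f \<longlonglongrightarrow> a" "g \<longlonglongrightarrow> b" "\<And>n. f n \<in> {0..1}" "\<And>n. g n \<in> {0..1}"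
  shows "(\<lambda>n. T (f n) (g n)) \<longlonglongrightarrow> T a b"
proof -
  have ab: "a \<in> {0..1}" "b \<in> {0..1}"
    using closed_sequentially[OF closed_atLeastAtMost] assms by blast+
  have c: "continuous_on ({0..1} \<times> {0..1}) (\<lambda>(x, y). T x y)"
    using cont_tnorm by (simp add: continuous_tnorm_def)
  have "(\<lambda>n. (f n, g n)) \<longlonglongrightarrow> (a, b)"
    using assms by (intro tendsto_intros)
  then have "(\<lambda>n. (\<lambda>(x, y). T x y) (f n, g n)) \<longlonglongrightarrow> (\<lambda>(x, y). T x y) (a, b)"
    by (rule continuous_on_tendsto_compose[OF c]) (use assms ab in auto)
  then show ?thesis by simp
qed

text \<open>
  An idempotent of a continuous t-norm is a local unit below itself: by the intermediate
  value theorem each \<open>x \<le> e\<close> is of the form \<open>T e y\<close>, which \<open>e\<close> absorbs.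
\<close>

lemma T_idempotent_absorb:
  assumes e: "e \<in> {0..1}" "T e e = e" and x: "0 \<le> x" "x \<le> e"
  shows "T x e = x"
proof -
  have c: "continuous_on {0..1} (\<lambda>y. T e y)"
    using e by (intro continuous_intros) auto
  have "T e 0 = 0"
    using T_le_right[of e 0] T_in[of e 0] e by simp
  then obtain y where y: "0 \<le> y" "y \<le> 1" "T e y = x"
    using IVT'[of "T e" 0 x 1] c x e by auto
  have "T x e = T e (T e y)"
    using T_comm[of x e] x y e by auto
  also have "\<dots> = x"
    using T_assoc[of e e y] e y by auto
  finally show ?thesis .
qed

lemma npow_in [simp]: "x \<in> {0..1} \<Longrightarrow> tnorm_npow T x n \<in> {0..1}"
proof (induction n)
  case (Suc n)
  then show ?case by (cases n) (auto simp del: atLeastAtMost_iff)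
qed simp

lemma npow_Suc: "x \<in> {0..1} \<Longrightarrow> tnorm_npow T x (Suc n) = T (tnorm_npow T x n) x"
  by (cases n) auto

lemma npow_add:
  assumes "x \<in> {0..1}"
  shows "tnorm_npow T x (m + n) = T (tnorm_npow T x m) (tnorm_npow T x n)"
proof (induction n)
  case 0
  then show ?case using npow_in[OF assms, of m] by simp
next
  case (Suc n)
  have "tnorm_npow T x (m + Suc n) = T (T (tnorm_npow T x m) (tnorm_npow T x n)) x"
    using Suc npow_Suc[OF assms, of "m + n"] by simp
  also have "\<dots> = T (tnorm_npow T x m) (tnorm_npow T x (Suc n))"
    using T_assoc[OF npow_in[OF assms] npow_in[OF assms] assms] npow_Suc[OF assms] by simp
  finally show ?case .
qed

lemma npow_mult:
  assumes "x \<in> {0..1}"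
  shows "tnorm_npow T x (m * n) = tnorm_npow T (tnorm_npow T x m) n"
proof (induction n)
  case (Suc n)
  then show ?case
    using npow_add[OF assms, of "m * n" m] npow_Suc[OF npow_in[OF assms]]
    by (simp add: add.commute)
qed simp

lemma npow_mono:
  assumes "x \<in> {0..1}" "y \<in> {0..1}" "x \<le> y"
  shows "tnorm_npow T x n \<le> tnorm_npow T y n"
proof (induction n)
  case (Suc n)
  then show ?case
    using T_mono[OF npow_in npow_in] npow_Suc assms by metis
qed simp

lemma npow_antimono:
  assumes "x \<in> {0..1}" "m \<le> n"
  shows "tnorm_npow T x n \<le> tnorm_npow T x m"
  using npow_add[OF assms(1), of m "n - m"] T_le_left[OF npow_in npow_in] assms by auto

lemma npow_one [simp]: "tnorm_npow T 1 n = 1"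
proof (induction n)
  case (Suc n)
  then show ?case using npow_Suc[of 1 n] by simp
qed simp

lemma npow_zero: "n \<ge> 1 \<Longrightarrow> tnorm_npow T 0 n = 0"
  using npow_antimono[of 0 1 n] npow_in[of 0 n] by simp

lemma continuous_npow: "continuous_on {0..1} (\<lambda>x. tnorm_npow T x n)"
proof (induction n)
  case (Suc n)
  have "continuous_on {0..1} (\<lambda>x. T (tnorm_npow T x n) x)"
    using Suc npow_in by (intro continuous_intros) auto
  then show ?case
    by (subst continuous_on_cong[OF refl npow_Suc]) auto
qed simp


section \<open>Roots and rational powers\<close>

lemma root_in [simp]:
  assumes "u \<in> {0..1}"
  shows "tnorm_root T u p \<in> {0..1}"
proof -
  define V where "V = {v \<in> {0..1}. tnorm_npow T v p < u}"
  show ?thesis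
  proof (cases "V = {}")
    case False
    then obtain v where v: "v \<in> V" by blast
    have "v \<le> Sup V" by (rule cSup_upper[OF v]) (auto simp: V_def bdd_above_def)
    moreover have "Sup V \<le> 1" by (rule cSup_least[OF False]) (auto simp: V_def)
    ultimately show ?thesis using v False unfolding tnorm_root_def V_def[symmetric]
      by (auto simp: V_def Let_def)
  next
    case True
    then show ?thesis unfolding tnorm_root_def V_def[symmetric] by simp
  qed
qed

text \<open>
  Together with \<open>npow_root\<close> this makes \<open>tnorm_root T u p\<close> the least \<open>p\<close>-th root of \<open>u\<close>;
  minimality is what singles out one root when the power map is not injective.
\<close>

lemma root_le:
  assumes "v \<in> {0..1}" "u \<le> tnorm_npow T v p"
  shows "tnorm_root T u p \<le> v"
proof -
  define V where "V = {v \<in> {0..1}. tnorm_npow T v p < u}"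
  have "w \<le> v" if "w \<in> V" for w
    using npow_mono[of v w p] that assms by (force simp: V_def)
  then show ?thesis
    using assms cSup_least[of V v] unfolding tnorm_root_def V_def[symmetric]
    by (auto simp: Let_def)
qed

lemma npow_root:
  assumes u: "u \<in> {0..1}" and p: "p \<ge> 1"
  shows "tnorm_npow T (tnorm_root T u p) p = u"
proof -
  have "\<exists>v. 0 \<le> v \<and> v \<le> 1 \<and> tnorm_npow T v p = u"
    using IVT'[of "\<lambda>v. tnorm_npow T v p" 0 u 1] continuous_npow npow_zero[OF p] u by auto
  then obtain v where v: "v \<in> {0..1}" "tnorm_npow T v p = u" by auto
  have r: "tnorm_root T u p \<in> {0..1}" using u by (rule root_in)
  have le: "tnorm_npow T (tnorm_root T u p) p \<le> u"
    using npow_mono[OF r v(1) root_le[OF v(1)], of p] v(2) by simp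
  show ?thesis
  proof (rule ccontr)
    assume "\<not> ?thesis"
    with le have lt: "tnorm_npow T (tnorm_root T u p) p < u" by simp
    \<comment> \<open>a value strictly between is attained to the right of the supremum\<close>
    obtain c where c: "tnorm_npow T (tnorm_root T u p) p < c" "c < u"
      using lt dense by blast
    obtain w where w: "tnorm_root T u p \<le> w" "w \<le> 1" "tnorm_npow T w p = c"
    proof -
      have "continuous_on {tnorm_root T u p..1} (\<lambda>v. tnorm_npow T v p)"
        by (rule continuous_on_subset[OF continuous_npow]) (use r in auto)
      moreover have "tnorm_root T u p \<le> 1" "c \<le> tnorm_npow T 1 p" using r c u by auto
      ultimately show ?thesis
        using IVT'[of "\<lambda>v. tnorm_npow T v p" "tnorm_root T u p" c 1] c that by auto
    qed
    define V where "V = {v \<in> {0..1}. tnorm_npow T v p < u}"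
    have "0 \<le> w" using r w(1) by auto
    then have wV: "w \<in> V" using w(2,3) c(2) by (simp add: V_def)
    have "w \<le> Sup V" by (rule cSup_upper[OF wV]) (auto simp: V_def bdd_above_def)
    also have "Sup V = tnorm_root T u p"
      using wV unfolding tnorm_root_def V_def[symmetric] Let_def by (metis empty_iff)
    finally show False using w(1,3) c(1) by simp
  qed
qed

lemma root_mono:
  assumes "u \<in> {0..1}" "u' \<in> {0..1}" "u \<le> u'" "p \<ge> 1"
  shows "tnorm_root T u p \<le> tnorm_root T u' p"
  using root_le[OF root_in] npow_root assms by metis

lemma qpow_in [simp]: "u \<in> {0..1} \<Longrightarrow> tnorm_qpow T u q p \<in> {0..1}"
  unfolding tnorm_qpow_def by (intro npow_in root_in)

lemma qpow_mono:
  assumes "u \<in> {0..1}" "u' \<in> {0..1}" "u \<le> u'" "p \<ge> 1"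
  shows "tnorm_qpow T u q p \<le> tnorm_qpow T u' q p"
  unfolding tnorm_qpow_def by (intro npow_mono root_mono root_in assms)

text \<open>
  Both inequalities come from minimality: the \<open>k\<close>-th power of the \<open>kp\<close>-th root is some
  \<open>p\<close>-th root, and the \<open>k\<close>-th root of the \<open>p\<close>-th root is some \<open>kp\<close>-th root.
\<close>

lemma npow_root_mult:
  assumes u: "u \<in> {0..1}" and k: "k \<ge> 1" and p: "p \<ge> 1"
  shows "tnorm_npow T (tnorm_root T u (k * p)) k = tnorm_root T u p"
proof (rule antisym)
  define w where "w = tnorm_root T u (k * p)"
  define r where "r = tnorm_root T u p"
  define z where "z = tnorm_root T r k"
  have in01: "w \<in> {0..1}" "r \<in> {0..1}" "z \<in> {0..1}"
    using u by (auto simp: w_def r_def z_def simp del: atLeastAtMost_iff)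
  have z: "tnorm_npow T z k = r"
    using npow_root[OF in01(2) k] by (simp add: z_def)
  have "tnorm_npow T z (k * p) = u"
    using npow_mult[OF in01(3), of k p] z npow_root[OF u p] by (simp add: r_def)
  then have "w \<le> z"
    using root_le[OF in01(3)] by (simp add: w_def)
  then show "tnorm_npow T (tnorm_root T u (k * p)) k \<le> tnorm_root T u p"
    using npow_mono[OF in01(1,3)] z by (fastforce simp: w_def r_def)
  have "tnorm_npow T (tnorm_npow T w k) p = u"
    using npow_mult[OF in01(1), of k p] npow_root[OF u, of "k * p"] k p by (simp add: w_def)
  then show "tnorm_root T u p \<le> tnorm_npow T (tnorm_root T u (k * p)) k"
    using root_le[OF npow_in[OF in01(1)]] by (simp add: w_def)
qed

lemma qpow_cancel:
  assumes "u \<in> {0..1}" "k \<ge> 1" "p \<ge> 1"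
  shows "tnorm_qpow T u (k * q) (k * p) = tnorm_qpow T u q p"
  unfolding tnorm_qpow_def
  by (simp add: npow_mult[OF root_in[OF assms(1)]] npow_root_mult[OF assms])

lemma qpow_antimono:
  assumes u: "u \<in> {0..1}" and p: "p \<ge> 1" "p' \<ge> 1" and le: "real q / real p \<le> real q' / real p'"
  shows "tnorm_qpow T u q' p' \<le> tnorm_qpow T u q p"
proof -
  have "real q * real p' \<le> real q' * real p"
    using le p by (simp add: field_simps)
  then have "q * p' \<le> q' * p"
    by (metis of_nat_le_iff of_nat_mult)
  then have le': "p' * q \<le> p * q'" by (simp add: mult.commute)
  have "tnorm_qpow T u q' p' = tnorm_qpow T u (p * q') (p * p')"
    using qpow_cancel[OF u p(1,2)] by simp
  also have "\<dots> \<le> tnorm_qpow T u (p' * q) (p * p')"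
    unfolding tnorm_qpow_def by (rule npow_antimono[OF root_in[OF u] le'])
  also have "\<dots> = tnorm_qpow T u q p"
    using qpow_cancel[OF u p(2,1), of q] by (simp add: mult.commute[of p p'])
  finally show ?thesis .
qed

lemma qpow_add:
  assumes u: "u \<in> {0..1}" and p: "p \<ge> 1" "p' \<ge> 1"
  shows "T (tnorm_qpow T u q p) (tnorm_qpow T u q' p') = tnorm_qpow T u (p' * q + p * q') (p * p')"
proof -
  have "tnorm_qpow T u (p' * q + p * q') (p * p') =
        T (tnorm_qpow T u (p' * q) (p' * p)) (tnorm_qpow T u (p * q') (p * p'))"
    unfolding tnorm_qpow_def by (simp add: npow_add[OF root_in[OF u]] mult.commute)
  then show ?thesis
    using qpow_cancel[OF u p(2,1)] qpow_cancel[OF u p] by simp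
qed


section \<open>Real powers\<close>

lemma rpow_le_qpow:
  assumes "u \<in> {0..1}" "p \<ge> 1" "real q / real p \<le> t"
  shows "tnorm_rpow T u t \<le> tnorm_qpow T u q p"
  unfolding tnorm_rpow_def
proof (rule cInf_lower)
  show "bdd_below {tnorm_qpow T u q p |q p. 1 \<le> p \<and> real q / real p \<le> t}"
    using qpow_in[OF assms(1)] by (intro bdd_belowI[of _ 0]) auto
qed (use assms in blast)

lemma rpow_set_nonempty:
  assumes "0 \<le> t"
  shows "{tnorm_qpow T u q p |q p. 1 \<le> p \<and> real q / real p \<le> t} \<noteq> {}"
proof -
  have "tnorm_qpow T u 0 1 \<in> {tnorm_qpow T u q p |q p. 1 \<le> p \<and> real q / real p \<le> t}"
    using assms by (intro CollectI exI[of _ 0] exI[of _ 1]) simp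
  then show ?thesis by blast
qed

lemma rpow_greatest:
  assumes "0 \<le> t" "\<And>q p. p \<ge> 1 \<Longrightarrow> real q / real p \<le> t \<Longrightarrow> m \<le> tnorm_qpow T u q p"
  shows "m \<le> tnorm_rpow T u t"
  unfolding tnorm_rpow_def
  by (rule cInf_greatest[OF rpow_set_nonempty[OF assms(1)]]) (use assms in auto)

lemma rpow_rat:
  assumes "u \<in> {0..1}" "p \<ge> 1"
  shows "tnorm_rpow T u (real q / real p) = tnorm_qpow T u q p"
  using assms by (intro antisym rpow_le_qpow rpow_greatest) (auto intro: qpow_antimono)

lemma rpow_zero_exp [simp]: "u \<in> {0..1} \<Longrightarrow> tnorm_rpow T u 0 = 1"
  using rpow_rat[of u 1 0] by (simp add: tnorm_qpow_def)

lemma rpow_one_exp [simp]: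
  assumes "u \<in> {0..1}"
  shows "tnorm_rpow T u 1 = u"
  using rpow_rat[of u 1 1] npow_root[of u 1] assms by (simp add: tnorm_qpow_def)

lemma rpow_in [simp]:
  assumes "u \<in> {0..1}" "0 \<le> t"
  shows "tnorm_rpow T u t \<in> {0..1}"
  using rpow_le_qpow[OF assms(1), of 1 0 t] rpow_greatest[of t 0 u] assms qpow_in[OF assms(1)]
  by (auto simp: tnorm_qpow_def)

lemma rpow_antimono:
  assumes "u \<in> {0..1}" "0 \<le> s" "s \<le> t"
  shows "tnorm_rpow T u t \<le> tnorm_rpow T u s"
  using assms by (intro rpow_greatest rpow_le_qpow) auto

lemma rpow_mono:
  assumes "u \<in> {0..1}" "u' \<in> {0..1}" "u \<le> u'" "0 \<le> t"
  shows "tnorm_rpow T u t \<le> tnorm_rpow T u' t"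
  using assms by (intro rpow_greatest) (auto intro: order_trans[OF rpow_le_qpow qpow_mono])

lemma nonneg_Rats_cases:
  assumes "r \<in> \<rat>" "0 \<le> (r::real)"
  obtains q p :: nat where "p \<ge> 1" "r = real q / real p"
proof -
  obtain q p :: nat where "p \<noteq> 0" "\<bar>r\<bar> = real q / real p"
    using Rats_abs_nat_div_natE[OF assms(1)] by metis
  then show ?thesis using that[of p q] assms by auto
qed

lemma rpow_add_Rats:
  assumes u: "u \<in> {0..1}" and r: "r \<in> \<rat>" "0 \<le> r" and s: "s \<in> \<rat>" "0 \<le> s"
  shows "T (tnorm_rpow T u r) (tnorm_rpow T u s) = tnorm_rpow T u (r + s)"
proof -
  obtain q p where qp: "p \<ge> 1" "r = real q / real p" using nonneg_Rats_cases[OF r] .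
  obtain q' p' where qp': "p' \<ge> 1" "s = real q' / real p'" using nonneg_Rats_cases[OF s] .
  have "r + s = real (p' * q + p * q') / real (p * p')"
    using qp qp' by (simp add: field_simps)
  then show ?thesis
    using qpow_add[OF u qp(1) qp'(1), of q q'] rpow_rat[OF u, of "p * p'" "p' * q + p * q'"]
      rpow_rat[OF u qp(1)] rpow_rat[OF u qp'(1)] qp qp' by simp
qed

lemma rpow_approx:
  assumes u: "u \<in> {0..1}" and t: "0 \<le> t"
  obtains r where "\<And>n::nat. r n \<in> \<rat>" "\<And>n. 0 \<le> r n" "\<And>n. r n \<le> t"
    "(\<lambda>n. tnorm_rpow T u (r n)) \<longlonglongrightarrow> tnorm_rpow T u t"
proof -
  have "\<exists>r. r \<in> \<rat> \<and> 0 \<le> r \<and> r \<le> t \<and> tnorm_rpow T u r < tnorm_rpow T u t + 1 / real (Suc n)" for n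
  proof -
    have "tnorm_rpow T u t < tnorm_rpow T u t + 1 / real (Suc n)" by simp
    then obtain q p where *: "p \<ge> 1" "real q / real p \<le> t"
      "tnorm_qpow T u q p < tnorm_rpow T u t + 1 / real (Suc n)"
      using cInf_lessD[OF rpow_set_nonempty[OF t]] unfolding tnorm_rpow_def by blast
    then show ?thesis using rpow_rat[OF u *(1)] by (intro exI[of _ "real q / real p"]) auto
  qed
  then obtain r where r: "\<And>n. r n \<in> \<rat>" "\<And>n. 0 \<le> r n" "\<And>n. r n \<le> t"
    "\<And>n. tnorm_rpow T u (r n) < tnorm_rpow T u t + 1 / real (Suc n)" by metis
  have "(\<lambda>n. tnorm_rpow T u t + 1 / real (Suc n)) \<longlonglongrightarrow> tnorm_rpow T u t + 0"
    by (intro tendsto_add tendsto_const LIMSEQ_inverse_real_of_nat[unfolded inverse_eq_divide])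
  then have upper: "(\<lambda>n. tnorm_rpow T u t + 1 / real (Suc n)) \<longlonglongrightarrow> tnorm_rpow T u t"
    by simp
  have "(\<lambda>n. tnorm_rpow T u (r n)) \<longlonglongrightarrow> tnorm_rpow T u t"
  proof (rule tendsto_sandwich[OF _ _ tendsto_const upper])
    show "\<forall>\<^sub>F n in sequentially. tnorm_rpow T u t \<le> tnorm_rpow T u (r n)"
      by (intro always_eventually allI rpow_antimono u r)
    show "\<forall>\<^sub>F n in sequentially. tnorm_rpow T u (r n) \<le> tnorm_rpow T u t + 1 / real (Suc n)"
      by (intro always_eventually allI less_imp_le r)
  qed
  with r that show ?thesis by blast
qed

text \<open>
  The powers with exponents \<open>1 / 2 ^ n\<close> increase to a limit \<open>e\<close>, which is idempotent because
  each of them is the \<open>T\<close>-square of the next one. Hence \<open>e\<close> acts as a unit on every value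
  bounded by some positive power of \<open>u\<close>. The limit need not be 1: for the minimum it is \<open>u\<close>.
\<close>

lemma rpow_small_exp_unit:
  assumes u: "u \<in> {0..1}" and s: "0 < s" and x: "0 \<le> x" "x \<le> tnorm_rpow T u s"
  shows "(\<lambda>n. T x (tnorm_rpow T u (1 / 2 ^ n))) \<longlonglongrightarrow> x"
proof -
  define a where "a n = tnorm_rpow T u (1 / 2 ^ n)" for n :: nat
  have a_in: "a n \<in> {0..1}" for n using u by (simp add: a_def del: atLeastAtMost_iff)
  have sq: "T (a (Suc n)) (a (Suc n)) = a n" for n
    using rpow_add_Rats[OF u, of "1 / 2 ^ Suc n" "1 / 2 ^ Suc n"] by (simp add: a_def)
  have inc: "incseq a"
    using T_le_left[OF a_in a_in] sq by (intro incseq_SucI) metis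
  have "\<forall>n. a n \<le> 1" using a_in by auto
  from incseq_convergent[OF inc this] obtain e where e: "a \<longlonglongrightarrow> e" "\<And>n. a n \<le> e" by auto
  have e_in: "e \<in> {0..1}"
    using closed_sequentially[OF closed_atLeastAtMost a_in e(1)] .
  have a_Suc: "(\<lambda>n. a (Suc n)) \<longlonglongrightarrow> e" using e(1) by (rule LIMSEQ_Suc)
  have "(\<lambda>n. T (a (Suc n)) (a (Suc n))) \<longlonglongrightarrow> T e e"
    by (rule tendsto_T[OF a_Suc a_Suc a_in a_in])
  then have "a \<longlonglongrightarrow> T e e" by (simp add: sq)
  then have idem: "T e e = e" using e(1) LIMSEQ_unique by blast
  obtain n where "(1 / 2) ^ n < s" using real_arch_pow_inv[OF s, of "1/2"] by auto
  then have "tnorm_rpow T u s \<le> a n"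
    unfolding a_def by (intro rpow_antimono[OF u]) (auto simp: power_one_over)
  then have xe: "x \<le> e" using x(2) e(2)[of n] by linarith
  have "(\<lambda>n. T x (a n)) \<longlonglongrightarrow> T x e"
    by (rule tendsto_T[OF tendsto_const e(1) _ a_in]) (use x xe e_in in auto)
  then show ?thesis unfolding T_idempotent_absorb[OF e_in idem x(1) xe] a_def .
qed

text \<open>
  The inequality \<open>\<ge>\<close> passes to the limit from rational exponents. For \<open>\<le>\<close> the exponent
  \<open>s + t\<close> may be rational while \<open>s\<close> and \<open>t\<close> are not, so rational approximation from below
  only yields exponents smaller than \<open>s + t\<close>. The missing left continuity is supplied by
  the powers with exponents \<open>1 / 2 ^ n\<close>, whose limit is a unit on the values concerned.
\<close>

lemma rpow_add_pos:
  assumes u: "u \<in> {0..1}" and s: "0 < s" and t: "0 < t"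
  shows "T (tnorm_rpow T u s) (tnorm_rpow T u t) = tnorm_rpow T u (s + t)"
proof (rule antisym)
  let ?P = "tnorm_rpow T u"
  obtain a where a: "\<And>n::nat. a n \<in> \<rat>" "\<And>n. 0 \<le> a n" "\<And>n. a n \<le> s"
    "(\<lambda>n. ?P (a n)) \<longlonglongrightarrow> ?P s"
    using rpow_approx[OF u less_imp_le[OF s]] by metis
  obtain b where b: "\<And>n::nat. b n \<in> \<rat>" "\<And>n. 0 \<le> b n" "\<And>n. b n \<le> t"
    "(\<lambda>n. ?P (b n)) \<longlonglongrightarrow> ?P t"
    using rpow_approx[OF u less_imp_le[OF t]] by metis
  have "(\<lambda>n. T (?P (a n)) (?P (b n))) \<longlonglongrightarrow> T (?P s) (?P t)"
    by (rule tendsto_T[OF a(4) b(4)]; intro rpow_in u a b)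
  moreover have "?P (s + t) \<le> T (?P (a n)) (?P (b n))" for n
    using rpow_add_Rats[OF u a(1,2) b(1,2)] rpow_antimono[OF u, of "a n + b n" "s + t"]
      a(2,3)[of n] b(2,3)[of n] by simp
  ultimately show "?P (s + t) \<le> T (?P s) (?P t)"
    by (intro LIMSEQ_le_const[where X = "\<lambda>n. T (?P (a n)) (?P (b n))"]) auto
next
  let ?P = "tnorm_rpow T u"
  define X where "X = T (?P s) (?P t)"
  have in01: "?P s \<in> {0..1}" "?P t \<in> {0..1}" using u s t by (auto simp del: atLeastAtMost_iff)
  have X_in: "X \<in> {0..1}" unfolding X_def by (rule T_in[OF in01])
  \<comment> \<open>half of the slack \<open>s + t - r\<close> is given to each of the two exponents\<close>
  have below: "X \<le> ?P r" if r: "0 \<le> r" "r < s + t" for r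
  proof -
    have "max 0 (s - (s + t - r) / 2) < s" "max 0 (t - (s + t - r) / 2) < t" using s t r by auto
    then obtain a b where
      a: "a \<in> \<rat>" "max 0 (s - (s + t - r) / 2) < a" "a < s" and
      b: "b \<in> \<rat>" "max 0 (t - (s + t - r) / 2) < b" "b < t"
      using Rats_dense_in_real by metis
    have rab: "r \<le> a + b" using a b by (simp add: field_simps)
    have "X \<le> T (?P a) (?P b)"
      unfolding X_def by (intro T_mono in01 rpow_in rpow_antimono u) (use a b in auto)
    also have "\<dots> = ?P (a + b)" using a b by (intro rpow_add_Rats u) auto
    also have "\<dots> \<le> ?P r" using rab r by (intro rpow_antimono u) auto
    finally show ?thesis .
  qed
  have "X \<le> ?P r" if r: "r \<in> \<rat>" "0 < r" "r \<le> s + t" for r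
  proof -
    have lim: "(\<lambda>n. T X (?P (1 / 2 ^ n))) \<longlonglongrightarrow> X"
      using X_in T_le_left[OF in01] by (intro rpow_small_exp_unit[OF u s]) (simp_all add: X_def)
    obtain N where N: "(1 / 2) ^ N < r" using real_arch_pow_inv[OF r(2), of "1/2"] by auto
    have "T X (?P (1 / 2 ^ n)) \<le> ?P r" if "n \<ge> N" for n
    proof -
      have "(1 / 2 :: real) ^ n \<le> (1 / 2) ^ N" using that by (intro power_decreasing) auto
      then have small: "1 / 2 ^ n < r" using N by (simp add: power_one_over)
      have "T X (?P (1 / 2 ^ n)) \<le> T (?P (r - 1 / 2 ^ n)) (?P (1 / 2 ^ n))"
        using small r by (intro T_mono X_in rpow_in u below) (auto intro: less_le_trans[of _ r])
      also have "\<dots> = ?P r"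
        using rpow_add_Rats[OF u, of "r - 1 / 2 ^ n" "1 / 2 ^ n"] small r by simp
      finally show ?thesis .
    qed
    then show ?thesis by (intro LIMSEQ_le_const2[OF lim]) auto
  qed
  note at_rat = this
  have "X \<le> tnorm_qpow T u q p" if "p \<ge> 1" "real q / real p \<le> s + t" for q p
  proof (cases "q = 0")
    case True
    then show ?thesis using X_in by (simp add: tnorm_qpow_def)
  next
    case False
    then show ?thesis
      using at_rat[of "real q / real p", unfolded rpow_rat[OF u that(1)]] that
      by (auto intro: divide_pos_pos Rats_divide)
  qed
  then have "X \<le> ?P (s + t)"
    using rpow_greatest[of "s + t" X u] s t by (meson add_nonneg_nonneg less_imp_le)
  then show "T (?P s) (?P t) \<le> ?P (s + t)" by (simp only: X_def)
qed

lemma rpow_add: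
  assumes u: "u \<in> {0..1}" and "0 \<le> s" "0 \<le> t"
  shows "T (tnorm_rpow T u s) (tnorm_rpow T u t) = tnorm_rpow T u (s + t)"
proof -
  consider "s = 0" | "t = 0" | "0 < s" "0 < t" using assms by linarith
  then show ?thesis
  proof cases
    case 1
    then show ?thesis using T_one_left[OF rpow_in] assms by simp
  next
    case 2
    then show ?thesis using T_one_right[OF rpow_in] assms by simp
  qed (rule rpow_add_pos[OF u])
qed

text \<open>
  A continuous t-norm never creates the value 1, whereas it may create 0 from positive
  arguments (nilpotent t-norms do). The extreme values of the mixed operator are therefore
  both characterised through the value 1, at \<open>u\<close> and at \<open>1 - u\<close>.
\<close>

lemma rpow_eq_one:
  assumes u: "u \<in> {0..1}" and t: "0 < t" and one: "tnorm_rpow T u t = 1"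
  shows "u = 1"
proof -
  obtain n where n: "inverse (real (Suc n)) < t" using reals_Archimedean[OF t] by auto
  have "1 \<le> tnorm_qpow T u 1 (Suc n)"
    using rpow_le_qpow[OF u, of "Suc n" 1 t] one n by (simp add: inverse_eq_divide)
  then have "tnorm_root T u (Suc n) = 1"
    using root_in[OF u, of "Suc n"] by (simp add: tnorm_qpow_def)
  then show ?thesis using npow_root[OF u, of "Suc n"] by simp
qed


section \<open>The weighted aggregate of a t-norm\<close>

text \<open>
  Starting from the unit 1 makes the recursion uniform; from one factor on it is the
  left-bracketed \<open>T\<close>-product of the weighted powers.
\<close>

primrec agg :: "(nat \<Rightarrow> real) \<Rightarrow> (nat \<Rightarrow> real) \<Rightarrow> nat \<Rightarrow> real" where
  "agg \<omega> x 0 = 1"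
| "agg \<omega> x (Suc n) = T (agg \<omega> x n) (tnorm_rpow T (x (Suc n)) (\<omega> (Suc n)))"

lemma agg_in:
  assumes "\<forall>l\<in>{1..n}. 0 \<le> \<omega> l" "\<forall>l\<in>{1..n}. x l \<in> {0..1}"
  shows "agg \<omega> x n \<in> {0..1}"
  using assms
proof (induction n)
  case (Suc n)
  have sub: "{1..n} \<subseteq> {1..Suc n}" by auto
  have top: "Suc n \<in> {1..Suc n}" by simp
  show ?case
    unfolding agg.simps by (intro T_in rpow_in Suc.IH) (use Suc.prems sub top in blast)+
qed simp

lemma agg_mono:
  assumes "\<forall>l\<in>{1..n}. 0 \<le> \<omega> l" "\<forall>l\<in>{1..n}. x l \<in> {0..1}" "\<forall>l\<in>{1..n}. y l \<in> {0..1}"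
    "\<forall>l\<in>{1..n}. x l \<le> y l"
  shows "agg \<omega> x n \<le> agg \<omega> y n"
  using assms
proof (induction n)
  case (Suc n)
  have sub: "{1..n} \<subseteq> {1..Suc n}" by auto
  have top: "Suc n \<in> {1..Suc n}" by simp
  show ?case
    unfolding agg.simps
    by (intro T_mono agg_in rpow_in rpow_mono Suc.IH) (use Suc.prems sub top in blast)+
qed simp

text \<open>
  Additivity of real exponents enters here only; with weights of sum 1 it yields
  idempotency, from which monotonicity gives the bounds.
\<close>

lemma agg_const:
  assumes "\<forall>l\<in>{1..n}. 0 \<le> \<omega> l" "c \<in> {0..1}"
  shows "agg \<omega> (\<lambda>_. c) n = tnorm_rpow T c (\<Sum>l=1..n. \<omega> l)"
  using assms
proof (induction n)
  case (Suc n)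
  have "0 \<le> (\<Sum>l=1..n. \<omega> l)" using Suc.prems by (intro sum_nonneg) auto
  then show ?case using Suc rpow_add[of c "\<Sum>l=1..n. \<omega> l" "\<omega> (Suc n)"] by simp
qed simp

lemma agg_eq_one:
  assumes "\<forall>l\<in>{1..n}. 0 < \<omega> l" "\<forall>l\<in>{1..n}. x l \<in> {0..1}" "agg \<omega> x n = 1"
  shows "\<forall>l\<in>{1..n}. x l = 1"
  using assms
proof (induction n)
  case (Suc n)
  have top: "0 < \<omega> (Suc n)" "x (Suc n) \<in> {0..1}" using Suc.prems by auto
  have A: "agg \<omega> x n \<in> {0..1}"
    using Suc.prems by (intro agg_in) (auto simp: less_imp_le)
  have B: "tnorm_rpow T (x (Suc n)) (\<omega> (Suc n)) \<in> {0..1}"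
    using top by (intro rpow_in) auto
  have "agg \<omega> x n = 1" "tnorm_rpow T (x (Suc n)) (\<omega> (Suc n)) = 1"
    using T_le_left[OF A B] T_le_right[OF A B] A B Suc.prems(3) by auto
  moreover have "x (Suc n) = 1" using rpow_eq_one[OF top(2,1)] calculation(2) .
  moreover have "\<forall>l\<in>{1..n}. 0 < \<omega> l" "\<forall>l\<in>{1..n}. x l \<in> {0..1}" using Suc.prems by auto
  ultimately have "\<forall>l\<in>{1..n}. x l = 1" "x (Suc n) = 1" using Suc.IH by blast+
  then show ?case by (metis atLeastAtMost_iff le_SucE)
qed simp

text \<open>Duality turns all powers of the t-conorm into powers of the t-norm at \<open>1 - u\<close>.\<close>

lemma tconorm_npow_dual: "tconorm_npow (dual_tconorm T) x n = 1 - tnorm_npow T (1 - x) n"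
  by (induction "dual_tconorm T" x n rule: tconorm_npow.induct) (auto simp: dual_tconorm_def)

lemma tconorm_root_dual: "tconorm_root (dual_tconorm T) u p = 1 - tnorm_root T (1 - u) p"
proof -
  define V where "V = {v \<in> {0..1}. tnorm_npow T v p < 1 - u}"
  have eq: "{v \<in> {0..1}. tconorm_npow (dual_tconorm T) v p > u} = (\<lambda>v. 1 - v) ` V"
  proof (intro set_eqI iffI)
    fix v assume "v \<in> {v \<in> {0..1}. tconorm_npow (dual_tconorm T) v p > u}"
    then have "1 - v \<in> V" by (auto simp: V_def tconorm_npow_dual)
    then show "v \<in> (\<lambda>v. 1 - v) ` V" by (rule rev_image_eqI) simp
  qed (auto simp: V_def tconorm_npow_dual)
  have "Inf ((\<lambda>v. 1 - v) ` V) = 1 - Sup V" if ne: "V \<noteq> {}"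
  proof (rule cInf_eq_non_empty)
    have bdd: "bdd_above V" by (auto simp: V_def bdd_above_def)
    show "1 - Sup V \<le> y" if "y \<in> (\<lambda>v. 1 - v) ` V" for y
      using that cSup_upper[OF _ bdd] by auto
    show "y \<le> 1 - Sup V" if "\<And>z. z \<in> (\<lambda>v. 1 - v) ` V \<Longrightarrow> y \<le> z" for y
      using cSup_least[OF ne, of "1 - y"] that by force
  qed (use ne in auto)
  then show ?thesis
    unfolding tconorm_root_def tnorm_root_def eq V_def[symmetric] by (auto simp: Let_def)
qed

lemma tconorm_rpow_dual:
  assumes u: "u \<in> {0..1}" and t: "0 \<le> t"
  shows "tconorm_rpow (dual_tconorm T) u t = 1 - tnorm_rpow T (1 - u) t"
proof -
  have u': "1 - u \<in> {0..1}" using u by auto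
  have q: "tconorm_qpow (dual_tconorm T) u q p = 1 - tnorm_qpow T (1 - u) q p" for q p
    by (simp add: tconorm_qpow_def tnorm_qpow_def tconorm_npow_dual tconorm_root_dual)
  show ?thesis
    unfolding tconorm_rpow_def q
  proof (rule cSup_eq_non_empty)
    show "{1 - tnorm_qpow T (1 - u) q p |q p. 1 \<le> p \<and> real q / real p \<le> t} \<noteq> {}"
      using rpow_set_nonempty[OF t] by auto
    show "x \<le> 1 - tnorm_rpow T (1 - u) t"
      if "x \<in> {1 - tnorm_qpow T (1 - u) q p |q p. 1 \<le> p \<and> real q / real p \<le> t}" for x
      using that rpow_le_qpow[OF u'] by auto
    show "1 - tnorm_rpow T (1 - u) t \<le> y"
      if y: "\<And>x. x \<in> {1 - tnorm_qpow T (1 - u) q p |q p. 1 \<le> p \<and> real q / real p \<le> t} \<Longrightarrow> x \<le> y" for y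
    proof -
      have "1 - y \<le> tnorm_rpow T (1 - u) t"
        by (rule rpow_greatest[OF t]) (use y in force)
      then show ?thesis by simp
    qed
  qed
qed

lemma IFWA_agg:
  assumes "1 \<le> n" "\<forall>l\<in>{1..n}. 0 \<le> \<omega> l" "\<forall>l\<in>{1..n}. \<gamma> l \<in> IFV"
  shows "IFWA T \<omega> n \<gamma> = (1 - agg \<omega> (\<lambda>l. 1 - \<mu> (\<gamma> l)) n, agg \<omega> (\<lambda>l. \<nu> (\<gamma> l)) n)"
  using assms
proof (induction n rule: nat_induct_at_least)
  case base
  then have "\<mu> (\<gamma> 1) \<in> {0..1}" "\<nu> (\<gamma> 1) \<in> {0..1}" "1 - \<mu> (\<gamma> 1) \<in> {0..1}" "0 \<le> \<omega> 1"
    by (auto simp: IFV_def)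
  then show ?case
    using rpow_in by (simp add: IFWA_def ifv_scale_def tconorm_rpow_dual del: atLeastAtMost_iff)
next
  case (Suc n)
  have IH: "IFWA T \<omega> n \<gamma> = (1 - agg \<omega> (\<lambda>l. 1 - \<mu> (\<gamma> l)) n, agg \<omega> (\<lambda>l. \<nu> (\<gamma> l)) n)"
    using Suc.prems by (intro Suc.IH) auto
  have "\<mu> (\<gamma> (Suc n)) \<in> {0..1}" "0 \<le> \<omega> (Suc n)" using Suc.prems by (auto simp: IFV_def)
  moreover have "IFWA T \<omega> (Suc n) \<gamma> =
      ifv_add T (IFWA T \<omega> n \<gamma>) (ifv_scale T (\<omega> (Suc n)) (\<gamma> (Suc n)))"
    using Suc.hyps by (simp add: IFWA_def)
  ultimately show ?case
    by (simp add: IH ifv_add_def ifv_scale_def tconorm_rpow_dual dual_tconorm_def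
        del: atLeastAtMost_iff)
qed

lemma IFWG_agg:
  assumes "1 \<le> n" "\<forall>l\<in>{1..n}. 0 \<le> \<omega> l" "\<forall>l\<in>{1..n}. \<gamma> l \<in> IFV"
  shows "IFWG T \<omega> n \<gamma> = (agg \<omega> (\<lambda>l. \<mu> (\<gamma> l)) n, 1 - agg \<omega> (\<lambda>l. 1 - \<nu> (\<gamma> l)) n)"
  using assms
proof (induction n rule: nat_induct_at_least)
  case base
  then have "\<mu> (\<gamma> 1) \<in> {0..1}" "\<nu> (\<gamma> 1) \<in> {0..1}" "1 - \<nu> (\<gamma> 1) \<in> {0..1}" "0 \<le> \<omega> 1"
    by (auto simp: IFV_def)
  then show ?case
    using rpow_in by (simp add: IFWG_def ifv_power_def tconorm_rpow_dual del: atLeastAtMost_iff)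
next
  case (Suc n)
  have IH: "IFWG T \<omega> n \<gamma> = (agg \<omega> (\<lambda>l. \<mu> (\<gamma> l)) n, 1 - agg \<omega> (\<lambda>l. 1 - \<nu> (\<gamma> l)) n)"
    using Suc.prems by (intro Suc.IH) auto
  have "\<nu> (\<gamma> (Suc n)) \<in> {0..1}" "0 \<le> \<omega> (Suc n)" using Suc.prems by (auto simp: IFV_def)
  moreover have "IFWG T \<omega> (Suc n) \<gamma> =
      ifv_mult T (IFWG T \<omega> n \<gamma>) (ifv_power T (\<gamma> (Suc n)) (\<omega> (Suc n)))"
    using Suc.hyps by (simp add: IFWG_def)
  ultimately show ?case
    by (simp add: IH ifv_mult_def ifv_power_def tconorm_rpow_dual dual_tconorm_def
        del: atLeastAtMost_iff)
qed


section \<open>The algebraic product\<close>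

context
  assumes prod: "\<And>u v. u \<in> {0..1} \<Longrightarrow> v \<in> {0..1} \<Longrightarrow> T u v = u * v"
begin

lemma npow_prod: "x \<in> {0..1} \<Longrightarrow> tnorm_npow T x n = x ^ n"
proof (induction n)
  case (Suc n)
  then show ?case using npow_Suc[of x n] prod[OF npow_in[of x n], of x] by simp
qed simp

lemma qpow_prod:
  assumes u: "u \<in> {0..1}" "0 < u" and p: "p \<ge> 1"
  shows "tnorm_qpow T u q p = u powr (real q / real p)"
proof -
  define r where "r = tnorm_root T u p"
  have r: "r \<in> {0..1}" "r ^ p = u"
    using npow_root[OF u(1) p] npow_prod root_in[OF u(1)] by (auto simp: r_def)
  then have "r \<noteq> 0" using u(2) p by (metis power_0_left less_irrefl not_one_le_zero)
  then have r0: "0 < r" using r by auto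
  have "u powr (real q / real p) = (r powr real p) powr (real q / real p)"
    using r r0 by (simp add: powr_realpow)
  also have "\<dots> = r powr real q" using p by (simp add: powr_powr)
  also have "\<dots> = tnorm_qpow T u q p"
    using npow_prod[OF r(1)] r0 by (simp add: tnorm_qpow_def r_def powr_realpow)
  finally show ?thesis by simp
qed

lemma rpow_prod:
  assumes u: "u \<in> {0..1}" and t: "0 < t"
  shows "tnorm_rpow T u t = u powr t"
proof (cases "u = 0")
  case True
  obtain n where n: "inverse (real (Suc n)) < t" using reals_Archimedean[OF t] by auto
  have "tnorm_root T u (Suc n) \<le> 0"
    by (rule root_le) (use True npow_zero[of "Suc n"] in auto)
  then have "tnorm_rpow T u t \<le> 0"
    using rpow_le_qpow[OF u, of "Suc n" 1 t] n by (simp add: tnorm_qpow_def inverse_eq_divide)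
  then show ?thesis using True rpow_in[OF u, of t] t by simp
next
  case False
  then have u0: "0 < u" using u by auto
  show ?thesis
  proof (rule antisym)
    show "tnorm_rpow T u t \<le> u powr t"
    proof (rule ccontr)
      assume "\<not> ?thesis"
      then have lt: "u powr t < tnorm_rpow T u t" by simp
      have "((\<lambda>r. u powr r) \<longlongrightarrow> u powr t) (at_left t)"
        using u0 by (intro tendsto_intros) auto
      from order_tendstoD(2)[OF this lt] obtain b where
        b: "b < t" "\<And>r. b < r \<Longrightarrow> r < t \<Longrightarrow> u powr r < tnorm_rpow T u t"
        unfolding eventually_at_left_field by auto
      obtain r where r: "r \<in> \<rat>" "max b 0 < r" "r < t"
        using Rats_dense_in_real[of "max b 0" t] b t by auto
      have "0 \<le> r" using r(2) by simp
      then obtain q p where "p \<ge> 1" "r = real q / real p" using nonneg_Rats_cases[OF r(1)] by metis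
      then have "tnorm_rpow T u t \<le> u powr r"
        using rpow_le_qpow[OF u, of p q t] qpow_prod[OF u u0, of p q] r by simp
      then show False using b(2)[of r] r by simp
    qed
    show "u powr t \<le> tnorm_rpow T u t"
      using t u u0 by (intro rpow_greatest) (auto simp: qpow_prod intro: powr_mono')
  qed
qed

lemma agg_prod:
  assumes "\<forall>l\<in>{1..n}. 0 < \<omega> l" "\<forall>l\<in>{1..n}. x l \<in> {0..1}"
  shows "agg \<omega> x n = (\<Prod>l=1..n. x l powr \<omega> l)"
  using assms
proof (induction n)
  case (Suc n)
  have top: "0 < \<omega> (Suc n)" "x (Suc n) \<in> {0..1}" using Suc.prems by auto
  have A: "agg \<omega> x n \<in> {0..1}"
    using Suc.prems by (intro agg_in) (auto simp: less_imp_le)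
  have B: "tnorm_rpow T (x (Suc n)) (\<omega> (Suc n)) \<in> {0..1}"
    using top by (intro rpow_in) auto
  show ?case using prod[OF A B] rpow_prod[OF top(2,1)] Suc by simp
qed simp

end

end


section \<open>The mixed weighted operator\<close>

lemma le_XuI:
  assumes "\<mu> \<alpha> \<le> \<mu> \<beta>" "\<nu> \<beta> \<le> \<nu> \<alpha>"
  shows "\<alpha> \<le>\<^sub>X\<^sub>u \<beta>"
  using assms unfolding le_Xu_def less_Xu_def score_def accuracy_def
  by (auto simp: prod_eq_iff)

theorem mainTheorem5:
  fixes T :: "real \<Rightarrow> real \<Rightarrow> real" and n :: nat
    and \<omega> :: "nat \<Rightarrow> real" and \<gamma> :: "nat \<Rightarrow> ifv"
  assumes T: "continuous_tnorm T"
    and n: "1 \<le> n"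
    and weights: "\<forall>l\<in>{1..n}. \<omega> l \<in> {0<..1}"
    and weights_sum: "(\<Sum>l=1..n. \<omega> l) = 1"
    and ifvs: "\<forall>j\<in>{1..n}. \<gamma> j \<in> IFV"
  shows
    "(IFMWAG T \<omega> n \<gamma> \<in> IFV) \<and>
     ((\<mu> (IFWA T \<omega> n \<gamma>) + \<mu> (IFWG T \<omega> n \<gamma>)) / 2 = 0 \<longleftrightarrow> (\<forall>j\<in>{1..n}. \<mu> (\<gamma> j) = 0)) \<and>
     ((\<mu> (IFWA T \<omega> n \<gamma>) + \<mu> (IFWG T \<omega> n \<gamma>)) / 2 = 1 \<longleftrightarrow> (\<forall>j\<in>{1..n}. \<mu> (\<gamma> j) = 1)) \<and>
     (\<forall>\<gamma>\<^sub>0\<in>IFV. (\<forall>j\<in>{1..n}. \<gamma> j = \<gamma>\<^sub>0) \<longrightarrow> IFMWAG T \<omega> n \<gamma> = \<gamma>\<^sub>0) \<and>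
     ((Min ((\<lambda>j. \<mu> (\<gamma> j)) ` {1..n}), Max ((\<lambda>j. \<nu> (\<gamma> j)) ` {1..n})) \<le>\<^sub>X\<^sub>u IFMWAG T \<omega> n \<gamma>) \<and>
     (IFMWAG T \<omega> n \<gamma> \<le>\<^sub>X\<^sub>u (Max ((\<lambda>j. \<mu> (\<gamma> j)) ` {1..n}), Min ((\<lambda>j. \<nu> (\<gamma> j)) ` {1..n}))) \<and>
     (\<forall>\<beta>. (\<forall>j\<in>{1..n}. \<beta> j \<in> IFV \<and> \<mu> (\<beta> j) \<ge> \<mu> (\<gamma> j) \<and> \<nu> (\<beta> j) \<le> \<nu> (\<gamma> j)) \<longrightarrow>
       IFMWAG T \<omega> n \<gamma> \<le>\<^sub>X\<^sub>u IFMWAG T \<omega> n \<beta>) \<and>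
     ((\<forall>u\<in>{0..1}. \<forall>v\<in>{0..1}. T u v = algebraic_product u v) \<longrightarrow>
       IFMWAG T \<omega> n \<gamma> =
         ((1 - (\<Prod>l=1..n. (1 - \<mu> (\<gamma> l)) powr \<omega> l) + (\<Prod>l=1..n. \<mu> (\<gamma> l) powr \<omega> l)) / 2,
          (1 - (\<Prod>l=1..n. (1 - \<nu> (\<gamma> l)) powr \<omega> l) + (\<Prod>l=1..n. \<nu> (\<gamma> l) powr \<omega> l)) / 2))"
proof -
  interpret cont_tnorm T by unfold_locales (rule T)
  have w0: "\<forall>l\<in>{1..n}. 0 < \<omega> l" and w: "\<forall>l\<in>{1..n}. 0 \<le> \<omega> l"
    using weights by (auto simp: less_imp_le)
  let ?G = "\<lambda>x. agg \<omega> x n"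
  \<comment> \<open>the same scalar mean acts on the membership and on the nonmembership degrees\<close>
  define M where "M x = (1 - ?G (\<lambda>l. 1 - x l) + ?G x) / 2" for x
  let ?I = "\<lambda>x. \<forall>l\<in>{1..n}. x l \<in> {0..1::real}"
  have I1: "?I (\<lambda>l. 1 - x l)" if "?I x" for x using that by auto
  have mean: "IFMWAG T \<omega> n \<beta> = (M (\<lambda>l. \<mu> (\<beta> l)), M (\<lambda>l. \<nu> (\<beta> l)))"
    if "\<forall>l\<in>{1..n}. \<beta> l \<in> IFV" for \<beta>
    using IFWA_agg[OF n w that] IFWG_agg[OF n w that] by (simp add: IFMWAG_def M_def)
  have G_in: "?G x \<in> {0..1}" if "?I x" for x using agg_in[OF w that] .
  have M_mono: "M x \<le> M y" if "?I x" "?I y" "\<forall>l\<in>{1..n}. x l \<le> y l" for x y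
    using agg_mono[OF w that] agg_mono[OF w I1[OF that(2)] I1[OF that(1)]] that
    by (auto simp: M_def)
  have M_const: "M (\<lambda>_. c) = c" if "c \<in> {0..1}" for c
    using agg_const[OF w, of c] agg_const[OF w, of "1 - c"] that weights_sum by (simp add: M_def)
  have M_cong_const: "M x = c" if "\<forall>l\<in>{1..n}. x l = c" "c \<in> {0..1}" for x c
    using M_mono[of x "\<lambda>_. c"] M_mono[of "\<lambda>_. c" x] M_const[of c] that by force
  have M_zero: "\<forall>l\<in>{1..n}. x l = 0" if "?I x" "M x = 0" for x
    using agg_eq_one[OF w0 I1[OF that(1)]] G_in[OF that(1)] G_in[OF I1[OF that(1)]] that(2)
    by (auto simp: M_def)
  have M_one: "\<forall>l\<in>{1..n}. x l = 1" if "?I x" "M x = 1" for x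
    using agg_eq_one[OF w0 that(1)] G_in[OF that(1)] G_in[OF I1[OF that(1)]] that(2)
    by (auto simp: M_def)
  have I_mu: "?I (\<lambda>l. \<mu> (\<beta> l))" and I_nu: "?I (\<lambda>l. \<nu> (\<beta> l))"
    if "\<forall>l\<in>{1..n}. \<beta> l \<in> IFV" for \<beta> using that by (auto simp: IFV_def)
  note I\<mu> = I_mu[OF ifvs] and I\<nu> = I_nu[OF ifvs]
  let ?m = "\<lambda>l. \<mu> (\<gamma> l)" and ?v = "\<lambda>l. \<nu> (\<gamma> l)"
  have M_in: "M x \<in> {0..1}" if "?I x" for x
    using G_in[OF that] G_in[OF I1[OF that]] by (auto simp: M_def)
  have "?G ?v \<le> ?G (\<lambda>l. 1 - ?m l)" "?G ?m \<le> ?G (\<lambda>l. 1 - ?v l)"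
    using ifvs by (auto intro!: agg_mono w simp: IFV_def algebra_simps)
  then have "M ?m + M ?v \<le> 1" unfolding M_def by argo
  then have c1: "IFMWAG T \<omega> n \<gamma> \<in> IFV"
    using M_in[OF I\<mu>] M_in[OF I\<nu>] by (simp add: mean[OF ifvs] IFV_def)
  have M_mu: "(\<mu> (IFWA T \<omega> n \<gamma>) + \<mu> (IFWG T \<omega> n \<gamma>)) / 2 = M ?m"
    using mean[OF ifvs] by (simp add: IFMWAG_def)
  have c2: "M ?m = 0 \<longleftrightarrow> (\<forall>j\<in>{1..n}. \<mu> (\<gamma> j) = 0)"
  proof
    show "M ?m = 0" if "\<forall>j\<in>{1..n}. \<mu> (\<gamma> j) = 0" by (rule M_cong_const[OF that]) simp
  qed (rule M_zero[OF I\<mu>])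
  have c3: "M ?m = 1 \<longleftrightarrow> (\<forall>j\<in>{1..n}. \<mu> (\<gamma> j) = 1)"
  proof
    show "M ?m = 1" if "\<forall>j\<in>{1..n}. \<mu> (\<gamma> j) = 1" by (rule M_cong_const[OF that]) simp
  qed (rule M_one[OF I\<mu>])
  have c4: "\<forall>\<gamma>\<^sub>0\<in>IFV. (\<forall>j\<in>{1..n}. \<gamma> j = \<gamma>\<^sub>0) \<longrightarrow> IFMWAG T \<omega> n \<gamma> = \<gamma>\<^sub>0"
  proof (intro ballI impI)
    fix \<gamma>\<^sub>0 assume g: "\<gamma>\<^sub>0 \<in> IFV" "\<forall>j\<in>{1..n}. \<gamma> j = \<gamma>\<^sub>0"
    have "M ?m = \<mu> \<gamma>\<^sub>0" "M ?v = \<nu> \<gamma>\<^sub>0"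
      by (rule M_cong_const; use g in \<open>simp add: IFV_def\<close>)+
    then show "IFMWAG T \<omega> n \<gamma> = \<gamma>\<^sub>0" by (simp add: mean[OF ifvs])
  qed
  have Min_le_M: "Min (x ` {1..n}) \<le> M x" and M_le_Max: "M x \<le> Max (x ` {1..n})" if x: "?I x" for x
  proof -
    have ne: "x ` {1..n} \<noteq> {}" using n by auto
    have "Min (x ` {1..n}) \<in> x ` {1..n}" "Max (x ` {1..n}) \<in> x ` {1..n}"
      using ne by (auto intro!: Min_in Max_in)
    moreover have "x ` {1..n} \<subseteq> {0..1}" using x unfolding image_subset_iff .
    ultimately have mm: "Min (x ` {1..n}) \<in> {0..1}" "Max (x ` {1..n}) \<in> {0..1}" by blast+
    show "Min (x ` {1..n}) \<le> M x"
      using M_mono[of "\<lambda>_. Min (x ` {1..n})" x] M_const[OF mm(1)] mm(1) x by simp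
    show "M x \<le> Max (x ` {1..n})"
      using M_mono[of x "\<lambda>_. Max (x ` {1..n})"] M_const[OF mm(2)] mm(2) x by simp
  qed
  have c5: "(Min (?m ` {1..n}), Max (?v ` {1..n})) \<le>\<^sub>X\<^sub>u IFMWAG T \<omega> n \<gamma>"
    using Min_le_M[OF I\<mu>] M_le_Max[OF I\<nu>] by (intro le_XuI) (simp_all add: mean[OF ifvs])
  have c6: "IFMWAG T \<omega> n \<gamma> \<le>\<^sub>X\<^sub>u (Max (?m ` {1..n}), Min (?v ` {1..n}))"
    using Min_le_M[OF I\<nu>] M_le_Max[OF I\<mu>] by (intro le_XuI) (simp_all add: mean[OF ifvs])
  have c7: "IFMWAG T \<omega> n \<gamma> \<le>\<^sub>X\<^sub>u IFMWAG T \<omega> n \<beta>"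
    if b: "\<forall>j\<in>{1..n}. \<beta> j \<in> IFV \<and> \<mu> (\<beta> j) \<ge> \<mu> (\<gamma> j) \<and> \<nu> (\<beta> j) \<le> \<nu> (\<gamma> j)" for \<beta>
  proof -
    have b': "\<forall>j\<in>{1..n}. \<beta> j \<in> IFV" using b by blast
    show ?thesis
      using M_mono[OF I\<mu> I_mu[OF b']] M_mono[OF I_nu[OF b'] I\<nu>] b
      by (intro le_XuI) (simp_all add: mean[OF ifvs] mean[OF b'])
  qed
  have c8: "IFMWAG T \<omega> n \<gamma> =
      ((1 - (\<Prod>l=1..n. (1 - \<mu> (\<gamma> l)) powr \<omega> l) + (\<Prod>l=1..n. \<mu> (\<gamma> l) powr \<omega> l)) / 2,
       (1 - (\<Prod>l=1..n. (1 - \<nu> (\<gamma> l)) powr \<omega> l) + (\<Prod>l=1..n. \<nu> (\<gamma> l) powr \<omega> l)) / 2)"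
    if p: "\<forall>u\<in>{0..1}. \<forall>v\<in>{0..1}. T u v = algebraic_product u v"
  proof -
    have G: "?G x = (\<Prod>l=1..n. x l powr \<omega> l)" if "?I x" for x
      by (rule agg_prod[OF _ w0 that]) (use p in \<open>simp add: algebraic_product_def\<close>)
    show ?thesis
      unfolding mean[OF ifvs] M_def G[OF I\<mu>] G[OF I\<nu>] G[OF I1[OF I\<mu>]] G[OF I1[OF I\<nu>]] ..
  qed
  show ?thesis
    unfolding M_mu using c1 c2 c3 c4 c5 c6 c7 c8 by blast
qed

end
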